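(* Let $K$ be a field and let $B\subseteq\mathbb Z^n$ be a simplicial affine semigroup with chosen linearly independent elements $e_1,\ldots,e_d\in B$ satisfying $C(\{e_1,\ldots,e_d\})=C(B)$. Let $A=\langle e_1,\ldots,e_d\rangle$, $T=K[A]$, and let the elements $h_1,\ldots,h_f\in C(B)\cap G(B)$ and the monomial ideals $I_1,\ldots,I_f$ of $T$ be as constructed in the context. Then there is an isomorphism of $\mathbb Z^n$-graded $T$-modules $$K[B]\cong\bigoplus_{j=1}^{f}I_j(-h_j).$$
   Context: An affine semigroup is a finitely generated submonoid of $(\mathbb Z^n,+)$ for some $n\in\mathbb N^+$ (here $0\in\mathbb N$). For a field $K$ and an affine semigroup $S\subseteq\mathbb Z^n$, $K[S]$ is the affine semigroup ring: the $K$-vector space with basis $\{t^s\mid s\in S\}$ and multiplication given by the $K$-bilinear extension of $t^a\cdot t^b=t^{a+b}$. It is $\mathbb Z^n$-graded by $\deg t^a=a$. For a $\mathbb Z^n$-graded module $M$ and $h\in\mathbb Z^n$, $M(-h)$ is the shifted module with $M(-h)_g=M_{g-h}$. For $X\subseteq\mathbb Q^n$, $C(X):=\{\sum\lambda_ix_i \text{ (finite sums)}\mid \lambda_i\in\mathbb Q_{\ge0},\ x_i\in X\}$ is the cone spanned by $X$; for $X\subseteq\mathbb Z^n$, $G(X)$ is the subgroup of $\mathbb Z^n$ generated by $X$, and $\langle X\rangle$ is the submonoid generated by $X$. An affine semigroup $B\subseteq\mathbb Z^n$ is simplicial if there are linearly independent $e_1,\ldots,e_d\in B$ with $C(\{e_1,\ldots,e_d\})=C(B)$.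 Fix such $e_1,\ldots,e_d$ and put $A:=\langle e_1,\ldots,e_d\rangle\subseteq B$; then $T:=K[A]$ is a polynomial ring in $d$ variables and $K[B]$ is a $T$-module via $T\subseteq K[B]$. For $x\in G(B)$ let $\lambda_1^x,\ldots,\lambda_d^x\in\mathbb Q$ be the unique rationals with $x=\sum_{i=1}^d\lambda_i^xe_i$. For $x,y\in G(B)$ write $x\sim y$ if $x-y\in G(A)$; this is an equivalence relation on $G(B)$. Define $$B_A:=\{x\in B\mid x-a\notin B\ \text{for all } a\in A\setminus\{0\}\},$$ which is a finite set. Let $\Gamma_1,\ldots,\Gamma_f$ be the equivalence classes of $\sim$ on $B_A$ (their number $f$ is finite), and for $j=1,\ldots,f$ define $$h_j:=\sum_{i=1}^d\min\{\lambda_i^x\mid x\in\Gamma_j\}\,e_i .$$ One has $h_j\in C(B)\cap G(B)$ (in particular $h_j\in\mathbb Z^n$) and $x-h_j\in A$ for all $x\in\Gamma_j$. Put $\tilde\Gamma_j:=\{t^{x-h_j}\mid x\in\Gamma_j\}\subseteq T$ and let $I_j:=\tilde\Gamma_jT$ be the monomial ideal of $T$ generated by $\tilde\Gamma_j$. *)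

theory Defs
  imports
    "HOL-Library.Poly_Mapping"
    "HOL-Computational_Algebra.Group_Closure"
    "HOL-Analysis.Cartesian_Space"
    "HOL-Algebra.Module"
    "HOL-Algebra.Ideal"
begin

section \<open>Affine semigroups\<close>

inductive_set monoid_closure :: "'a::comm_monoid_add set \<Rightarrow> 'a set" for X
  where zero: "0 \<in> monoid_closure X"
  | base: "x \<in> X \<Longrightarrow> x \<in> monoid_closure X"
  | add: "x \<in> monoid_closure X \<Longrightarrow> y \<in> monoid_closure X \<Longrightarrow> x + y \<in> monoid_closure X"

definition affine_semigroup :: "(int ^ 'n) set \<Rightarrow> bool"
  where "affine_semigroup S \<longleftrightarrow> (\<exists>X. finite X \<and> S = monoid_closure X)"

text \<open>The inclusion of \<open>\<int>\<^sup>n\<close> into \<open>\<rat>\<^sup>n\<close>.\<close>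

definition rat_vec :: "int ^ 'n \<Rightarrow> rat ^ 'n"
  where "rat_vec x = (\<chi> i. of_int (x $ i))"

definition rat_cone :: "(rat ^ 'n) set \<Rightarrow> (rat ^ 'n) set"
  where "rat_cone X = {\<Sum>x\<in>F. c x *s x | F c. finite F \<and> F \<subseteq> X \<and> (\<forall>x\<in>F. 0 \<le> c x)}"

text \<open>\<open>lin_indep_family d e\<close>: the vectors \<open>e 1, \<dots>, e d\<close> are (pairwise distinct and) linearly
  independent over \<open>\<rat>\<close>; equivalently over \<open>\<int>\<close>.\<close>

definition lin_indep_family :: "nat \<Rightarrow> (nat \<Rightarrow> int ^ 'n) \<Rightarrow> bool"
  where "lin_indep_family d e \<longleftrightarrow>
    inj_on e {1..d} \<and> vec.independent (rat_vec ` e ` {1..d})"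


section \<open>Graded rings and modules\<close>

text \<open>A graded object carries its homogeneous components as an additional record field.
  The same record type is used for graded rings, for which \<open>smult\<close> plays no role, and for graded
  modules, for which \<open>mult\<close> and \<open>one\<close> play no role.\<close>

record ('a, 'b, 'g) graded_mod = "('a, 'b) module" +
  homog :: "'g \<Rightarrow> 'b set"

text \<open>The carrier is the internal direct sum of the components.\<close>

definition graded :: "('a, 'b, 'g, 'm) graded_mod_scheme \<Rightarrow> bool"
  where "graded M \<longleftrightarrow>
    (\<forall>g. subgroup (homog M g) (add_monoid M)) \<and>
    (\<forall>m\<in>carrier M. \<exists>!u. (\<forall>g. u g \<in> homog M g) \<and> finite {g. u g \<noteq> \<zero>\<^bsub>M\<^esub>} \<and>
        m = finsum M u {g. u g \<noteq> \<zero>\<^bsub>M\<^esub>})"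

definition graded_ring :: "('c, 'a, 'g::comm_monoid_add, 'm) graded_mod_scheme \<Rightarrow> bool"
  where "graded_ring R \<longleftrightarrow>
    cring R \<and> graded R \<and> \<one>\<^bsub>R\<^esub> \<in> homog R 0 \<and>
    (\<forall>g h. \<forall>a\<in>homog R g. \<forall>b\<in>homog R h. a \<otimes>\<^bsub>R\<^esub> b \<in> homog R (g + h))"

definition graded_module ::
    "('c, 'a, 'g::comm_monoid_add, 'm) graded_mod_scheme \<Rightarrow>
     ('a, 'b, 'g, 'n) graded_mod_scheme \<Rightarrow> bool"
  where "graded_module R M \<longleftrightarrow>
    graded_ring R \<and> Module.module R M \<and> graded M \<and>
    (\<forall>g h. \<forall>a\<in>homog R g. \<forall>x\<in>homog M h. a \<odot>\<^bsub>M\<^esub> x \<in> homog M (g + h))"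

definition graded_isomorphic ::
    "('c, 'a, 'g::comm_monoid_add, 'm) graded_mod_scheme \<Rightarrow>
     ('a, 'b, 'g, 'n) graded_mod_scheme \<Rightarrow> ('a, 'd, 'g, 'o) graded_mod_scheme \<Rightarrow> bool"
  where "graded_isomorphic R M N \<longleftrightarrow>
    graded_module R M \<and> graded_module R N \<and>
    (\<exists>\<phi>\<in>Group.iso (add_monoid M) (add_monoid N).
       (\<forall>a\<in>carrier R. \<forall>x\<in>carrier M. \<phi> (a \<odot>\<^bsub>M\<^esub> x) = a \<odot>\<^bsub>N\<^esub> \<phi> x) \<and>
       (\<forall>g. \<phi> ` homog M g = homog N g))"

text \<open>\<open>twist M k\<close> is the shifted module \<open>M(k)\<close> with \<open>M(k)\<^sub>g = M\<^sub>g\<^sub>+\<^sub>k\<close>.\<close>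

definition twist ::
    "('a, 'b, 'g::ab_group_add) graded_mod \<Rightarrow> 'g \<Rightarrow> ('a, 'b, 'g) graded_mod"
  where "twist M k = M\<lparr>homog := \<lambda>g. homog M (g + k)\<rparr>"

definition ideal_module ::
    "('a, 'a, 'g) graded_mod \<Rightarrow> 'a set \<Rightarrow> ('a, 'a, 'g) graded_mod"
  where "ideal_module R I =
    R\<lparr>carrier := I, smult := mult R, homog := \<lambda>g. I \<inter> homog R g\<rparr>"

definition direct_sum ::
    "'i set \<Rightarrow> ('i \<Rightarrow> ('a, 'b, 'g) graded_mod) \<Rightarrow> ('a, 'i \<Rightarrow> 'b, 'g) graded_mod"
  where "direct_sum J M =
    \<lparr> carrier = {x \<in> \<Pi>\<^sub>E j\<in>J. carrier (M j). finite {j \<in> J. x j \<noteq> \<zero>\<^bsub>M j\<^esub>}},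
      mult = (\<lambda>x y. \<lambda>j\<in>J. x j \<otimes>\<^bsub>M j\<^esub> y j),
      one = (\<lambda>j\<in>J. \<one>\<^bsub>M j\<^esub>),
      zero = (\<lambda>j\<in>J. \<zero>\<^bsub>M j\<^esub>),
      add = (\<lambda>x y. \<lambda>j\<in>J. x j \<oplus>\<^bsub>M j\<^esub> y j),
      smult = (\<lambda>a x. \<lambda>j\<in>J. a \<odot>\<^bsub>M j\<^esub> x j),
      homog = (\<lambda>g. {x \<in> \<Pi>\<^sub>E j\<in>J. homog (M j) g. finite {j \<in> J. x j \<noteq> \<zero>\<^bsub>M j\<^esub>}}) \<rparr>"


section \<open>Semigroup rings\<close>

text \<open>\<open>K[S]\<close> is realised inside the group ring of finitely supported functions on the ambient
  group, whose multiplication is convolution; the basis element \<open>t\<^sup>s\<close> is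
  \<open>Poly_Mapping.single s 1\<close>. For \<open>A \<subseteq> S\<close> the same record is \<open>K[S]\<close> as a \<open>K[A]\<close>-module.\<close>

definition semigroup_ring ::
    "'k::field itself \<Rightarrow> 'g::ab_group_add set \<Rightarrow> ('g \<Rightarrow>\<^sub>0 'k, 'g \<Rightarrow>\<^sub>0 'k, 'g) graded_mod"
  where "semigroup_ring K S =
    \<lparr> carrier = {p. Poly_Mapping.keys p \<subseteq> S},
      mult = (*), one = 1, zero = 0, add = (+), smult = (*),
      homog = (\<lambda>g. {p. Poly_Mapping.keys p \<subseteq> S \<inter> {g}}) \<rparr>"


section \<open>The decomposition data of a simplicial affine semigroup\<close>

definition base_elements :: "'g::ab_group_add set \<Rightarrow> 'g set \<Rightarrow> 'g set"
  where "base_elements B A = {x \<in> B. \<forall>a\<in>A - {0}. x - a \<notin> B}"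

definition sim_rel :: "'g::ab_group_add set \<Rightarrow> 'g set \<Rightarrow> ('g \<times> 'g) set"
  where "sim_rel B A =
    {(x, y). x \<in> group_closure B \<and> y \<in> group_closure B \<and> x - y \<in> group_closure A}"

definition base_classes :: "'g::ab_group_add set \<Rightarrow> 'g set \<Rightarrow> 'g set set"
  where "base_classes B A = base_elements B A // Restr (sim_rel B A) (base_elements B A)"

text \<open>\<open>coord d e x i\<close> is the coefficient \<open>\<lambda>\<^sub>i\<^sup>x\<close> of \<open>e i\<close> in \<open>x\<close>.\<close>

definition coord :: "nat \<Rightarrow> (nat \<Rightarrow> int ^ 'n) \<Rightarrow> int ^ 'n \<Rightarrow> nat \<Rightarrow> rat"
  where "coord d e x i = vec.representation (rat_vec ` e ` {1..d}) (rat_vec x) (rat_vec (e i))"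

text \<open>The rational combination below has integer entries for every class \<open>\<Gamma>\<close>, since
  the coordinates of any two elements of \<open>\<Gamma>\<close> differ by integers.\<close>

definition shift_vector :: "nat \<Rightarrow> (nat \<Rightarrow> int ^ 'n) \<Rightarrow> (int ^ 'n) set \<Rightarrow> int ^ 'n"
  where "shift_vector d e \<Gamma> =
    (THE h. rat_vec h = (\<Sum>i=1..d. Min {coord d e x i | x. x \<in> \<Gamma>} *s rat_vec (e i)))"

definition class_ideal ::
    "'k::field itself \<Rightarrow> nat \<Rightarrow> (nat \<Rightarrow> int ^ 'n) \<Rightarrow> (int ^ 'n) set \<Rightarrow> (int ^ 'n) set
      \<Rightarrow> (int ^ 'n \<Rightarrow>\<^sub>0 'k) set"
  where "class_ideal K d e A \<Gamma> =
    genideal (semigroup_ring K A)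
      {Poly_Mapping.single (x - shift_vector d e \<Gamma>) 1 | x. x \<in> \<Gamma>}"

end

theory Submission
  imports Defs
begin

text \<open>Every \<open>b \<in> B\<close> is \<open>x + a\<close> with \<open>x \<in> B\<^sub>A\<close> and \<open>a \<in> A\<close>, and elements of different classes
  \<open>\<Gamma>\<close> are incongruent modulo \<open>G(A)\<close>. Hence \<open>B\<close> is the disjoint union of the \<open>A\<close>-stable sets \<open>\<Gamma> + A\<close>,
  and \<open>K[B]\<close> splits accordingly. Multiplication by \<open>t\<^sup>-\<^sup>h\<close>, where \<open>h\<close> is the shift vector of \<open>\<Gamma>\<close>, carries
  the summand of \<open>\<Gamma>\<close> onto the span of the monomials with exponent in \<open>(\<Gamma> - h) + A\<close>, which is the
  monomial ideal of \<open>\<Gamma>\<close>.\<close>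

section \<open>Graded modules\<close>

text \<open>The degree shift cannot be carried out inside \<open>K[B]\<close>, because h need not
  lie in B. All rings, ideals and summands are therefore subsets of the group ring of the lattice,
  where t^h is a unit; each of them consists of the functions with exponents in a prescribed set, so
  that algebraic claims become claims about sets of exponents. The cone condition gives every
  element of B nonnegative rational coordinates, and clearing denominators puts a positive multiple
  of it into A. This makes the set of base elements finite, so there are finitely many classes and
  the minima defining h are attained. Linear independence makes coordinates unique, so congruence
  modulo G(A) forces integral differences of coordinates. Together these make the coordinates of x -
  h natural numbers for x in the class, which is exactly membership of x - h in A. It also shows
  that h, defined through rational minima, is a lattice vector.\<close>

text \<open>Nothing is assumed about \<open>N\<close>: the whole structure is carried over along the bijection.\<close>

lemma graded_isomorphic_transport:
  fixes R :: "('c, 'a, 'g::comm_monoid_add, 'm) graded_mod_scheme"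
    and M :: "('a, 'b, 'g, 'n) graded_mod_scheme"
    and N :: "('a, 'd, 'g, 'o) graded_mod_scheme"
  assumes gm: "graded_module R M"
    and bij: "bij_betw \<phi> (carrier M) (carrier N)"
    and add: "\<And>x y. x \<in> carrier M \<Longrightarrow> y \<in> carrier M \<Longrightarrow> \<phi> (x \<oplus>\<^bsub>M\<^esub> y) = \<phi> x \<oplus>\<^bsub>N\<^esub> \<phi> y"
    and zero: "\<phi> \<zero>\<^bsub>M\<^esub> = \<zero>\<^bsub>N\<^esub>"
    and smult: "\<And>a x. a \<in> carrier R \<Longrightarrow> x \<in> carrier M \<Longrightarrow> \<phi> (a \<odot>\<^bsub>M\<^esub> x) = a \<odot>\<^bsub>N\<^esub> \<phi> x"
    and homog: "\<And>g. \<phi> ` homog M g = homog N g"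
  shows "graded_isomorphic R M N"
proof -
  have gr: "graded_ring R" and mod: "Module.module R M" and grM: "graded M"
    and act: "\<And>g h a x. a \<in> homog R g \<Longrightarrow> x \<in> homog M h \<Longrightarrow> a \<odot>\<^bsub>M\<^esub> x \<in> homog M (g + h)"
    using gm by (auto simp: graded_module_def)
  interpret M: Module.module R M by (rule mod)
  have sub: "subgroup (homog M g) (add_monoid M)" for g
    using grM by (simp add: graded_def)
  have homM: "homog M g \<subseteq> carrier M" for g
    using subgroup.subset[OF sub] by simp
  have homR: "homog R g \<subseteq> carrier R" for g
    using gr subgroup.subset[of "homog R g" "add_monoid R"] by (simp add: graded_ring_def graded_def)
  have im: "\<phi> ` carrier M = carrier N" and inj: "inj_on \<phi> (carrier M)"
    using bij by (auto simp: bij_betw_def)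
  have phic: "\<phi> x \<in> carrier N" if "x \<in> carrier M" for x using that im by auto
  have carN: "\<exists>x\<in>carrier M. y = \<phi> x" if "y \<in> carrier N" for y using that im by auto
  interpret N: abelian_group N
  proof (rule abelian_groupI)
    fix x y z assume "x \<in> carrier N" "y \<in> carrier N" "z \<in> carrier N"
    then obtain x' y' z' where c: "x' \<in> carrier M" "y' \<in> carrier M" "z' \<in> carrier M"
      and e: "x = \<phi> x'" "y = \<phi> y'" "z = \<phi> z'" using carN by meson
    show "x \<oplus>\<^bsub>N\<^esub> y \<oplus>\<^bsub>N\<^esub> z = x \<oplus>\<^bsub>N\<^esub> (y \<oplus>\<^bsub>N\<^esub> z)"
      using c by (simp add: e add[symmetric] M.a_assoc)
  next
    fix x y assume "x \<in> carrier N" "y \<in> carrier N"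
    then obtain x' y' where c: "x' \<in> carrier M" "y' \<in> carrier M"
      and e: "x = \<phi> x'" "y = \<phi> y'" using carN by meson
    show "x \<oplus>\<^bsub>N\<^esub> y \<in> carrier N" "x \<oplus>\<^bsub>N\<^esub> y = y \<oplus>\<^bsub>N\<^esub> x"
      using c by (simp_all add: e add[symmetric] M.a_comm phic)
  next
    show "\<zero>\<^bsub>N\<^esub> \<in> carrier N" using phic[of "\<zero>\<^bsub>M\<^esub>"] zero by simp
  next
    fix x assume "x \<in> carrier N"
    then obtain x' where c: "x' \<in> carrier M" and e: "x = \<phi> x'" using carN by meson
    show "\<zero>\<^bsub>N\<^esub> \<oplus>\<^bsub>N\<^esub> x = x"
      using c by (simp add: e zero[symmetric] add[symmetric])
    show "\<exists>y\<in>carrier N. y \<oplus>\<^bsub>N\<^esub> x = \<zero>\<^bsub>N\<^esub>"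
      using c by (intro bexI[of _ "\<phi> (\<ominus>\<^bsub>M\<^esub> x')"])
        (simp_all add: e zero[symmetric] add[symmetric] M.l_neg phic)
  qed
  have iso: "\<phi> \<in> Group.iso (add_monoid M) (add_monoid N)"
    using bij add phic by (auto simp: Group.iso_def hom_def)
  interpret h: group_hom "add_monoid M" "add_monoid N" \<phi>
    by (intro group_hom.intro group_hom_axioms.intro M.a_group N.a_group)
      (use iso in \<open>auto simp: Group.iso_def\<close>)
  have modN: "Module.module R N"
  proof (rule moduleI)
    show "cring R" by unfold_locales
    show "abelian_group N" by unfold_locales
  next
    fix a x assume a: "a \<in> carrier R" and "x \<in> carrier N"
    then obtain x' where c: "x' \<in> carrier M" and e: "x = \<phi> x'" using carN by meson
    show "a \<odot>\<^bsub>N\<^esub> x \<in> carrier N"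
      using a c by (simp add: e smult[symmetric] phic)
  next
    fix a b x assume a: "a \<in> carrier R" "b \<in> carrier R" and "x \<in> carrier N"
    then obtain x' where c: "x' \<in> carrier M" and e: "x = \<phi> x'" using carN by meson
    show "(a \<oplus>\<^bsub>R\<^esub> b) \<odot>\<^bsub>N\<^esub> x = a \<odot>\<^bsub>N\<^esub> x \<oplus>\<^bsub>N\<^esub> b \<odot>\<^bsub>N\<^esub> x"
      "(a \<otimes>\<^bsub>R\<^esub> b) \<odot>\<^bsub>N\<^esub> x = a \<odot>\<^bsub>N\<^esub> (b \<odot>\<^bsub>N\<^esub> x)"
      using a c by (simp_all add: e smult[symmetric] add[symmetric] M.smult_l_distr M.smult_assoc1)
  next
    fix a x y assume a: "a \<in> carrier R" and "x \<in> carrier N" "y \<in> carrier N"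
    then obtain x' y' where c: "x' \<in> carrier M" "y' \<in> carrier M"
      and e: "x = \<phi> x'" "y = \<phi> y'" using carN by meson
    show "a \<odot>\<^bsub>N\<^esub> (x \<oplus>\<^bsub>N\<^esub> y) = a \<odot>\<^bsub>N\<^esub> x \<oplus>\<^bsub>N\<^esub> a \<odot>\<^bsub>N\<^esub> y"
      using a c by (simp add: e smult[symmetric] add[symmetric] M.smult_r_distr)
  next
    fix x assume "x \<in> carrier N"
    then obtain x' where c: "x' \<in> carrier M" and e: "x = \<phi> x'" using carN by meson
    show "\<one>\<^bsub>R\<^esub> \<odot>\<^bsub>N\<^esub> x = x"
      using c by (simp add: e smult[symmetric])
  qed
  have finsum: "\<phi> (finsum M u F) = finsum N (\<lambda>g. \<phi> (u g)) F"
    if "finite F" "\<And>g. u g \<in> carrier M" for u :: "'g \<Rightarrow> 'b" and F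
    using that
  proof (induction F rule: finite_induct)
    case empty
    then show ?case by (simp add: zero)
  next
    case (insert x F)
    then show ?case
      by (subst M.finsum_insert, simp, simp, simp add: Pi_def, simp,
        subst N.finsum_insert, simp, simp, simp add: Pi_def phic, simp add: phic)
        (simp add: add M.finsum_closed Pi_def)
  qed
  \<comment> \<open>A family of components and its image under \<open>\<phi>\<close> have the same
    support, so the two \<open>finsum\<close> expressions range over the same index set.\<close>
  have eq0: "\<phi> x = \<zero>\<^bsub>N\<^esub> \<longleftrightarrow> x = \<zero>\<^bsub>M\<^esub>" if "x \<in> carrier M" for x
    using inj_onD[OF inj, of x "\<zero>\<^bsub>M\<^esub>"] that zero by auto
  have "graded N"
    unfolding graded_def
  proof (intro conjI allI ballI)
    fix g show "subgroup (homog N g) (add_monoid N)"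
      using h.subgroup_img_is_subgroup[OF sub[of g]] by (simp add: homog)
  next
    fix m assume "m \<in> carrier N"
    then obtain m' where m': "m' \<in> carrier M" and m: "m = \<phi> m'" using carN by meson
    from grM m' obtain u where u: "\<And>g. u g \<in> homog M g" "finite {g. u g \<noteq> \<zero>\<^bsub>M\<^esub>}"
        "m' = finsum M u {g. u g \<noteq> \<zero>\<^bsub>M\<^esub>}"
      and uniq: "\<And>v. \<forall>g. v g \<in> homog M g \<Longrightarrow> finite {g. v g \<noteq> \<zero>\<^bsub>M\<^esub>} \<Longrightarrow>
        m' = finsum M v {g. v g \<noteq> \<zero>\<^bsub>M\<^esub>} \<Longrightarrow> v = u"
      unfolding graded_def by metis
    have uc: "u g \<in> carrier M" for g using u(1) homM by blast
    show "\<exists>!u. (\<forall>g. u g \<in> homog N g) \<and> finite {g. u g \<noteq> \<zero>\<^bsub>N\<^esub>} \<and>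
        m = finsum N u {g. u g \<noteq> \<zero>\<^bsub>N\<^esub>}"
    proof (rule ex1I[of _ "\<lambda>g. \<phi> (u g)"])
      show "(\<forall>g. \<phi> (u g) \<in> homog N g) \<and> finite {g. \<phi> (u g) \<noteq> \<zero>\<^bsub>N\<^esub>} \<and>
        m = finsum N (\<lambda>g. \<phi> (u g)) {g. \<phi> (u g) \<noteq> \<zero>\<^bsub>N\<^esub>}"
        using u(1) homog finsum[OF u(2) uc] u(2,3) by (auto simp: eq0 uc m)
    next
      fix v assume v: "(\<forall>g. v g \<in> homog N g) \<and> finite {g. v g \<noteq> \<zero>\<^bsub>N\<^esub>} \<and>
        m = finsum N v {g. v g \<noteq> \<zero>\<^bsub>N\<^esub>}"
      \<comment> \<open>Uniqueness is pulled back: the components of a competing decomposition lift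
        to \<open>M\<close>, where the decomposition of \<open>m'\<close> is already unique.\<close>
      then have "\<forall>g. \<exists>x\<in>homog M g. v g = \<phi> x" using homog by (metis imageE)
      then obtain w where w: "\<And>g. w g \<in> homog M g" "\<And>g. v g = \<phi> (w g)" by metis
      have wc: "w g \<in> carrier M" for g using w(1) homM by blast
      have s: "{g. v g \<noteq> \<zero>\<^bsub>N\<^esub>} = {g. w g \<noteq> \<zero>\<^bsub>M\<^esub>}" by (simp add: w eq0 wc)
      have fin: "finite {g. w g \<noteq> \<zero>\<^bsub>M\<^esub>}" using v s by simp
      have "\<phi> m' = \<phi> (finsum M w {g. w g \<noteq> \<zero>\<^bsub>M\<^esub>})"
        using finsum[OF fin wc] v s m w(2) by (simp add: w(2)[abs_def, symmetric])
      then have "m' = finsum M w {g. w g \<noteq> \<zero>\<^bsub>M\<^esub>}"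
        using inj m' wc by (simp add: inj_on_def M.finsum_closed Pi_def)
      then have "w = u" using uniq w fin by simp
      then show "v = (\<lambda>g. \<phi> (u g))" using w(2) by auto
    qed
  qed
  moreover have "a \<odot>\<^bsub>N\<^esub> y \<in> homog N (g + h)" if a: "a \<in> homog R g" and y: "y \<in> homog N h" for g h a y
  proof -
    from y homog obtain x where x: "x \<in> homog M h" "y = \<phi> x" by blast
    then have "a \<odot>\<^bsub>N\<^esub> y = \<phi> (a \<odot>\<^bsub>M\<^esub> x)"
      using smult[of a x] subsetD[OF homR a] subsetD[OF homM x(1)] by simp
    then show ?thesis using act[OF a x(1)] homog by blast
  qed
  ultimately show ?thesis
    using gm gr modN iso smult homog
    unfolding graded_isomorphic_def graded_module_def[of R N] by blast
qed

section \<open>Semigroup rings\<close>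

lemma semigroup_ring_simps [simp]:
  "carrier (semigroup_ring K S) = {p. Poly_Mapping.keys p \<subseteq> S}"
  "x \<otimes>\<^bsub>semigroup_ring K S\<^esub> y = x * y"
  "\<one>\<^bsub>semigroup_ring K S\<^esub> = 1"
  "\<zero>\<^bsub>semigroup_ring K S\<^esub> = 0"
  "x \<oplus>\<^bsub>semigroup_ring K S\<^esub> y = x + y"
  "x \<odot>\<^bsub>semigroup_ring K S\<^esub> y = x * y"
  "homog (semigroup_ring K S) g = {p. Poly_Mapping.keys p \<subseteq> S \<inter> {g}}"
  by (simp_all add: semigroup_ring_def)

lemma keys_uminus [simp]: "Poly_Mapping.keys (- p) = Poly_Mapping.keys (p :: 'a \<Rightarrow>\<^sub>0 'b::ab_group_add)"
  by (auto simp: in_keys_iff)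

lemma keys_add_subset: "Poly_Mapping.keys p \<subseteq> S \<Longrightarrow> Poly_Mapping.keys q \<subseteq> S \<Longrightarrow> Poly_Mapping.keys (p + q) \<subseteq> S"
  using Poly_Mapping.keys_add[of p q] by blast

lemma keys_mult_subset:
  assumes "Poly_Mapping.keys p \<subseteq> S" "Poly_Mapping.keys q \<subseteq> T"
    "\<And>s t. s \<in> S \<Longrightarrow> t \<in> T \<Longrightarrow> s + t \<in> U"
  shows "Poly_Mapping.keys (p * q) \<subseteq> U"
  using keys_mult[of p q] assms by blast

lemma abelian_group_semigroup_ring: "abelian_group (semigroup_ring K S)"
proof (rule abelian_groupI)
  fix x assume "x \<in> carrier (semigroup_ring K S)"
  then show "\<exists>y\<in>carrier (semigroup_ring K S). y \<oplus>\<^bsub>semigroup_ring K S\<^esub> x = \<zero>\<^bsub>semigroup_ring K S\<^esub>"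
    by (intro bexI[of _ "- x"]) auto
qed (auto simp: keys_add_subset algebra_simps)

text \<open>Passes from the sum of the record to the sum of the type class, for which coefficients
  can be computed by \<open>lookup_sum\<close>. Infinite index sets are covered too, as both
  conventions give zero.\<close>

lemma finsum_semigroup_ring:
  assumes "\<And>i. i \<in> F \<Longrightarrow> Poly_Mapping.keys (u i) \<subseteq> S"
  shows "finsum (semigroup_ring K S) u F = sum u F"
proof -
  interpret abelian_group "semigroup_ring K S" by (rule abelian_group_semigroup_ring)
  show ?thesis using assms
    by (induction F rule: infinite_finite_induct) (simp_all add: Pi_def finsum_infinite)
qed

text \<open>The free set \<open>U\<close> serves two purposes: \<open>S \<inter> {g}\<close> yields
  a homogeneous component, and the exponent set of a monomial ideal yields its additive
  group.\<close>

lemma subgroup_add_semigroup_ring: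
  assumes "U \<subseteq> S"
  shows "subgroup {p. Poly_Mapping.keys p \<subseteq> U} (add_monoid (semigroup_ring K S))"
proof -
  interpret abelian_group "semigroup_ring K S" by (rule abelian_group_semigroup_ring)
  have inv: "inv\<^bsub>add_monoid (semigroup_ring K S)\<^esub> p = - p" if "Poly_Mapping.keys p \<subseteq> S" for p
    using that by (intro minus_equality[unfolded a_inv_def]) auto
  show ?thesis
    by (rule group.subgroupI[OF a_group])
      (use assms inv in \<open>auto simp: keys_add_subset subset_trans intro!: exI[of _ 0]\<close>)
qed

lemma poly_mapping_eq_sum_single:
  "p = (\<Sum>k\<in>Poly_Mapping.keys p. Poly_Mapping.single k (Poly_Mapping.lookup p k))"
  by (rule poly_mapping_eqI) (simp add: lookup_sum lookup_single when_def in_keys_iff)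

text \<open>The components of \<open>m\<close> are its terms. They are forced: in any decomposition
  only the component of degree g can contribute to the coefficient at g.\<close>

lemma graded_semigroup_ring: "graded (semigroup_ring K S)"
  unfolding graded_def
proof (intro conjI allI ballI)
  fix g show "subgroup (homog (semigroup_ring K S) g) (add_monoid (semigroup_ring K S))"
    using subgroup_add_semigroup_ring[of "S \<inter> {g}" S K] by simp
next
  fix m assume "m \<in> carrier (semigroup_ring K S)"
  then have m: "Poly_Mapping.keys m \<subseteq> S" by simp
  let ?u = "\<lambda>g. Poly_Mapping.single g (Poly_Mapping.lookup m g)"
  have supp: "{g. ?u g \<noteq> 0} = Poly_Mapping.keys m"
    by (auto simp: in_keys_iff) (metis lookup_single_eq lookup_zero)
  show "\<exists>!u. (\<forall>g. u g \<in> homog (semigroup_ring K S) g) \<and>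
      finite {g. u g \<noteq> \<zero>\<^bsub>semigroup_ring K S\<^esub>} \<and>
      m = finsum (semigroup_ring K S) u {g. u g \<noteq> \<zero>\<^bsub>semigroup_ring K S\<^esub>}"
  proof (rule ex1I[of _ ?u])
    show "(\<forall>g. ?u g \<in> homog (semigroup_ring K S) g) \<and>
      finite {g. ?u g \<noteq> \<zero>\<^bsub>semigroup_ring K S\<^esub>} \<and>
      m = finsum (semigroup_ring K S) ?u {g. ?u g \<noteq> \<zero>\<^bsub>semigroup_ring K S\<^esub>}"
      using m poly_mapping_eq_sum_single[of m] supp
      by (subst finsum_semigroup_ring) (auto simp: in_keys_iff split: if_splits)
  next
    fix v assume v: "(\<forall>g. v g \<in> homog (semigroup_ring K S) g) \<and>
      finite {g. v g \<noteq> \<zero>\<^bsub>semigroup_ring K S\<^esub>} \<and>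
      m = finsum (semigroup_ring K S) v {g. v g \<noteq> \<zero>\<^bsub>semigroup_ring K S\<^esub>}"
    then have k: "\<And>g. Poly_Mapping.keys (v g) \<subseteq> S" "\<And>g. Poly_Mapping.keys (v g) \<subseteq> {g}"
      and fin: "finite {g. v g \<noteq> 0}" by auto
    have ms: "m = (\<Sum>g | v g \<noteq> 0. v g)" using v k by (simp add: finsum_semigroup_ring)
    have v0: "Poly_Mapping.lookup (v g) h = 0" if "h \<noteq> g" for g h
      using k(2)[of g] that by (auto simp: in_keys_iff)
    have "Poly_Mapping.lookup m g = Poly_Mapping.lookup (v g) g" for g
    proof -
      have "Poly_Mapping.lookup m g = (\<Sum>h | v h \<noteq> 0. if g = h then Poly_Mapping.lookup (v g) g else 0)"
        unfolding ms lookup_sum by (intro sum.cong) (auto simp: v0)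
      then show ?thesis using fin by (auto simp: sum.delta)
    qed
    then show "v = ?u"
      by (intro ext poly_mapping_eqI) (auto simp: lookup_single when_def v0)
  qed
qed

lemma cring_semigroup_ring:
  assumes "0 \<in> A" "\<And>a b. a \<in> A \<Longrightarrow> b \<in> A \<Longrightarrow> a + b \<in> A"
  shows "cring (semigroup_ring K A)"
proof (rule cringI[OF abelian_group_semigroup_ring])
  show "comm_monoid (semigroup_ring K A)"
    by (rule comm_monoidI)
      (use assms in \<open>simp_all add: keys_mult_subset[where S = A and T = A] mult.assoc mult.commute\<close>)
qed (simp add: algebra_simps)

lemma graded_ring_semigroup_ring:
  assumes "0 \<in> A" "\<And>a b. a \<in> A \<Longrightarrow> b \<in> A \<Longrightarrow> a + b \<in> A"
  shows "graded_ring (semigroup_ring K A)"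
  unfolding graded_ring_def
proof (intro conjI allI ballI)
  fix g h a b assume "a \<in> homog (semigroup_ring K A) g" "b \<in> homog (semigroup_ring K A) h"
  then show "a \<otimes>\<^bsub>semigroup_ring K A\<^esub> b \<in> homog (semigroup_ring K A) (g + h)"
    using keys_mult_subset[of a "A \<inter> {g}" b "A \<inter> {h}" "A \<inter> {g + h}"] assms(2) by auto
qed (use assms in \<open>auto simp: cring_semigroup_ring graded_semigroup_ring\<close>)

lemma graded_module_semigroup_ring:
  assumes "0 \<in> A" "\<And>a b. a \<in> A \<Longrightarrow> b \<in> A \<Longrightarrow> a + b \<in> A"
    and "\<And>a b. a \<in> A \<Longrightarrow> b \<in> B \<Longrightarrow> a + b \<in> B"
  shows "graded_module (semigroup_ring K A) (semigroup_ring K B)"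
  unfolding graded_module_def
proof (intro conjI allI ballI)
  show "Module.module (semigroup_ring K A) (semigroup_ring K B)"
    by (rule moduleI[OF cring_semigroup_ring abelian_group_semigroup_ring])
      (use assms in \<open>simp_all add: keys_mult_subset[where S = A and T = B] algebra_simps\<close>)
  fix g h a b assume "a \<in> homog (semigroup_ring K A) g" "b \<in> homog (semigroup_ring K B) h"
  then show "a \<odot>\<^bsub>semigroup_ring K B\<^esub> b \<in> homog (semigroup_ring K B) (g + h)"
    using keys_mult_subset[of a "A \<inter> {g}" b "B \<inter> {h}" "B \<inter> {g + h}"] assms(3) by auto
qed (use assms in \<open>auto simp: graded_ring_semigroup_ring graded_semigroup_ring\<close>)

section \<open>Monomial ideals of a semigroup ring\<close>

text \<open>The set X + A absorbs A, so the right side is an ideal, and it contains the generators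
  because 0 is in A. Conversely every term c t^(x+a) is the generator t^x times the ring element c
  t^a, and each \<open>p\<close> is the sum of its terms.\<close>

lemma genideal_monomials:
  fixes A :: "'g::ab_group_add set" and K :: "'k::field itself"
  assumes A: "0 \<in> A" "\<And>a b. a \<in> A \<Longrightarrow> b \<in> A \<Longrightarrow> a + b \<in> A" and X: "X \<subseteq> A"
  shows "genideal (semigroup_ring K A) {Poly_Mapping.single x 1 | x. x \<in> X} =
    {p. Poly_Mapping.keys p \<subseteq> {x + a | x a. x \<in> X \<and> a \<in> A}}"
    (is "genideal ?R ?G = {p. _ \<subseteq> ?S}")
proof
  interpret R: cring ?R by (rule cring_semigroup_ring) (use A in auto)
  have SA: "?S \<subseteq> A" using A X by auto
  have G: "?G \<subseteq> carrier ?R" using X by auto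
  have SS: "s + a \<in> ?S" if "s \<in> ?S" "a \<in> A" for s a
  proof -
    from that(1) obtain x b where "s = x + b" "x \<in> X" "b \<in> A" by blast
    then have "s + a = x + (b + a)" "b + a \<in> A" using A(2) that(2) by (simp_all add: add.assoc)
    with \<open>x \<in> X\<close> show ?thesis by blast
  qed
  have "ideal {p. Poly_Mapping.keys p \<subseteq> ?S} ?R"
  proof (rule idealI[OF R.ring_axioms subgroup_add_semigroup_ring[OF SA]])
    fix p q :: "'g \<Rightarrow>\<^sub>0 'k" assume pq: "p \<in> {p. Poly_Mapping.keys p \<subseteq> ?S}" "q \<in> carrier ?R"
    then have "Poly_Mapping.keys (p * q) \<subseteq> ?S"
      by (intro keys_mult_subset[of p ?S q A]) (use SS in auto)
    then show "q \<otimes>\<^bsub>?R\<^esub> p \<in> {p. Poly_Mapping.keys p \<subseteq> ?S}" "p \<otimes>\<^bsub>?R\<^esub> q \<in> {p. Poly_Mapping.keys p \<subseteq> ?S}"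
      by (simp_all add: mult.commute)
  qed
  moreover have "?G \<subseteq> {p. Poly_Mapping.keys p \<subseteq> ?S}" using A(1) by force
  ultimately show "genideal ?R ?G \<subseteq> {p. Poly_Mapping.keys p \<subseteq> ?S}"
    by (rule R.genideal_minimal)
  interpret I: ideal "genideal ?R ?G" ?R by (rule R.genideal_ideal[OF G])
  have mon: "Poly_Mapping.single s c \<in> genideal ?R ?G" if "s \<in> ?S" for s c
  proof -
    from that obtain x a where s: "s = x + a" "x \<in> X" "a \<in> A" by blast
    have "Poly_Mapping.single x 1 \<in> genideal ?R ?G" using R.genideal_self[OF G] s by blast
    then have "Poly_Mapping.single x 1 \<otimes>\<^bsub>?R\<^esub> Poly_Mapping.single a c \<in> genideal ?R ?G"
      using s by (intro I.I_r_closed) auto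
    then show ?thesis by (simp add: mult_single s)
  qed
  have sum: "sum u F \<in> genideal ?R ?G" if "finite F" "\<And>i. i \<in> F \<Longrightarrow> u i \<in> genideal ?R ?G" for u :: "'g \<Rightarrow> _" and F
    using that by (induction F rule: finite_induct) (use I.zero_closed I.a_closed in auto)
  show "{p. Poly_Mapping.keys p \<subseteq> ?S} \<subseteq> genideal ?R ?G"
  proof
    fix p :: "'g \<Rightarrow>\<^sub>0 'k" assume "p \<in> {p. Poly_Mapping.keys p \<subseteq> ?S}"
    then have "(\<Sum>k\<in>Poly_Mapping.keys p. Poly_Mapping.single k (Poly_Mapping.lookup p k)) \<in> genideal ?R ?G"
      by (intro sum mon) auto
    then show "p \<in> genideal ?R ?G" using poly_mapping_eq_sum_single[of p] by simp
  qed
qed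

section \<open>Projection onto a set of exponents, and splitting of a semigroup ring\<close>

text \<open>This is the projection onto the span of the monomials with exponent in \<open>S\<close>.
  Written as a finite sum of terms, it has finite support by construction.\<close>

definition restrict_keys :: "'a set \<Rightarrow> ('a \<Rightarrow>\<^sub>0 'b::comm_monoid_add) \<Rightarrow> 'a \<Rightarrow>\<^sub>0 'b"
  where "restrict_keys S p =
    (\<Sum>k\<in>Poly_Mapping.keys p \<inter> S. Poly_Mapping.single k (Poly_Mapping.lookup p k))"

lemma lookup_restrict_keys:
  "Poly_Mapping.lookup (restrict_keys S p) k = (if k \<in> S then Poly_Mapping.lookup p k else 0)"
  by (simp add: restrict_keys_def lookup_sum lookup_single when_def in_keys_iff)

lemma keys_restrict_keys: "Poly_Mapping.keys (restrict_keys S p) = Poly_Mapping.keys p \<inter> S"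
  by (auto simp: in_keys_iff lookup_restrict_keys split: if_splits)

lemma restrict_keys_add: "restrict_keys S (p + q) = restrict_keys S p + restrict_keys S q"
  by (rule poly_mapping_eqI) (simp add: lookup_restrict_keys lookup_add)

lemma restrict_keys_zero [simp]: "restrict_keys S 0 = 0"
  by (rule poly_mapping_eqI) (simp add: lookup_restrict_keys)

lemma restrict_keys_sum: "restrict_keys S (sum f F) = (\<Sum>i\<in>F. restrict_keys S (f i))"
  by (induction F rule: infinite_finite_induct) (simp_all add: restrict_keys_add)

lemma restrict_keys_id: "Poly_Mapping.keys p \<subseteq> S \<Longrightarrow> restrict_keys S p = p"
  by (rule poly_mapping_eqI) (auto simp: lookup_restrict_keys in_keys_iff)

lemma restrict_keys_disjoint: "Poly_Mapping.keys p \<inter> S = {} \<Longrightarrow> restrict_keys S p = 0"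
  by (rule poly_mapping_eqI) (auto simp: lookup_restrict_keys in_keys_iff)

text \<open>Split \<open>p\<close> into its part on \<open>S\<close> and the rest. Multiplication by
  \<open>a\<close> keeps the first part inside \<open>S\<close> and the second outside, so
  projecting the product retains exactly the first. This is the source of the linearity of the
  isomorphism over \<open>K[A]\<close>.\<close>

lemma restrict_keys_mult:
  fixes p :: "'g::comm_monoid_add \<Rightarrow>\<^sub>0 'k::comm_ring_1"
  assumes a: "Poly_Mapping.keys a \<subseteq> A" and p: "Poly_Mapping.keys p \<subseteq> B"
    and S: "\<And>a s. a \<in> A \<Longrightarrow> s \<in> S \<Longrightarrow> a + s \<in> S"
    and B: "\<And>a s. a \<in> A \<Longrightarrow> s \<in> B - S \<Longrightarrow> a + s \<notin> S"
  shows "restrict_keys S (a * p) = a * restrict_keys S p"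
proof -
  have "p = restrict_keys S p + restrict_keys (- S) p"
    by (rule poly_mapping_eqI) (simp add: lookup_restrict_keys lookup_add)
  then have "a * p = a * restrict_keys S p + a * restrict_keys (- S) p"
    by (metis distrib_left)
  moreover have "Poly_Mapping.keys (a * restrict_keys S p) \<subseteq> S"
    by (rule keys_mult_subset[OF a, where T = S]) (simp_all add: keys_restrict_keys S)
  moreover have "Poly_Mapping.keys (a * restrict_keys (- S) p) \<subseteq> - S"
    by (rule keys_mult_subset[OF a, where T = "B - S"]) (use p B in \<open>auto simp: keys_restrict_keys\<close>)
  ultimately show ?thesis
    by (simp add: restrict_keys_add restrict_keys_id restrict_keys_disjoint disjoint_eq_subset_Compl)
qed

lemma keys_single_mult: "Poly_Mapping.keys (Poly_Mapping.single g c * p) \<subseteq> (+) g ` Poly_Mapping.keys p"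
  by (rule keys_mult_subset[where S = "{g}" and T = "Poly_Mapping.keys p"]) auto

text \<open>Monomials are units of the group ring; the trailing factor \<open>p\<close> lets the
  cancellation fire inside right-nested products.\<close>

lemma single_mult_single_uminus [simp]:
  fixes g :: "'g::ab_group_add" and p :: "'g \<Rightarrow>\<^sub>0 'k::comm_ring_1"
  shows "Poly_Mapping.single g 1 * (Poly_Mapping.single (- g) 1 * p) = p"
    and "Poly_Mapping.single (- g) 1 * (Poly_Mapping.single g 1 * p) = p"
  by (simp_all add: mult.assoc[symmetric] mult_single)

text \<open>The map sends p to the tuple of its projections onto the pieces \<open>S j\<close>, each
  multiplied by t^(-h_j). This multiplication is invertible, commutes with the action of
  \<open>K[A]\<close>, and lowers degrees by h_j, which is what the twist by -h_j compensates.
  Disjointness makes the projections independent, and stability makes them linear.\<close>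

lemma semigroup_ring_decomposition:
  fixes A B :: "'g::ab_group_add set" and K :: "'k::field itself"
    and J :: "'j set" and S :: "'j \<Rightarrow> 'g set" and h :: "'j \<Rightarrow> 'g" and I :: "'j \<Rightarrow> ('g \<Rightarrow>\<^sub>0 'k) set"
  assumes A: "0 \<in> A" "\<And>a b. a \<in> A \<Longrightarrow> b \<in> A \<Longrightarrow> a + b \<in> A"
    and J: "finite J"
    and B: "B = (\<Union>j\<in>J. S j)"
    and disj: "\<And>i j. i \<in> J \<Longrightarrow> j \<in> J \<Longrightarrow> i \<noteq> j \<Longrightarrow> S i \<inter> S j = {}"
    and stable: "\<And>j a s. j \<in> J \<Longrightarrow> a \<in> A \<Longrightarrow> s \<in> S j \<Longrightarrow> a + s \<in> S j"
    and shift: "\<And>j s. j \<in> J \<Longrightarrow> s \<in> S j \<Longrightarrow> s - h j \<in> A"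
    and I: "\<And>j. j \<in> J \<Longrightarrow> I j = {p. Poly_Mapping.keys p \<subseteq> (\<lambda>s. s - h j) ` S j}"
  shows "graded_isomorphic (semigroup_ring K A) (semigroup_ring K B)
    (direct_sum J (\<lambda>j. twist (ideal_module (semigroup_ring K A) (I j)) (- h j)))"
    (is "graded_isomorphic ?R ?M ?N")
proof (rule graded_isomorphic_transport)
  define t :: "'g \<Rightarrow> 'g \<Rightarrow>\<^sub>0 'k" where "t g = Poly_Mapping.single g 1" for g
  define \<phi> where "\<phi> p = (\<lambda>j\<in>J. t (- h j) * restrict_keys (S j) p)" for p
  have t_inv [simp]: "t g * (t (- g) * p) = p" "t (- g) * (t g * p) = p" for g p
    by (simp_all add: t_def)
  have t_keys: "Poly_Mapping.keys (t g * p) \<subseteq> (+) g ` Poly_Mapping.keys p" for g p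
    unfolding t_def by (rule keys_single_mult)
  \<comment> \<open>Since \<open>J\<close> is finite, the finite support condition in
    \<open>direct_sum\<close> is automatic and the carrier is the full product.\<close>
  have carN: "carrier ?N = (\<Pi>\<^sub>E j\<in>J. I j)"
    using J by (auto simp: direct_sum_def twist_def ideal_module_def)
  have homN: "homog ?N g = (\<Pi>\<^sub>E j\<in>J. I j \<inter> {p. Poly_Mapping.keys p \<subseteq> {g - h j}})" for g
  proof -
    have "(\<Pi>\<^sub>E j\<in>J. I j \<inter> {p. Poly_Mapping.keys p \<subseteq> A \<inter> {g - h j}}) =
        (\<Pi>\<^sub>E j\<in>J. I j \<inter> {p. Poly_Mapping.keys p \<subseteq> {g - h j}})"
      using I shift by (intro PiE_cong) blast
    then show ?thesis
      using J by (simp add: direct_sum_def twist_def ideal_module_def)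
  qed
  show "graded_module ?R ?M"
  proof (rule graded_module_semigroup_ring[OF A])
    fix a b assume "a \<in> A" "b \<in> B" then show "a + b \<in> B" unfolding B using stable by blast
  qed
  have restr: "Poly_Mapping.keys (restrict_keys (S j) p) \<subseteq> S j" for j and p :: "'g \<Rightarrow>\<^sub>0 'k"
    by (simp add: keys_restrict_keys)
  have phi_I: "t (- h j) * restrict_keys (S j) p \<in> I j" if "j \<in> J" for j p
    using t_keys[of "- h j" "restrict_keys (S j) p"] restr[of j p] I[OF that] by auto
  have phi_car: "\<phi> p \<in> carrier ?N" for p
    unfolding carN by (auto simp: \<phi>_def phi_I)
  have restr_phi: "restrict_keys (S j) p = t (h j) * \<phi> p j" if "j \<in> J" for j p
    using that by (simp add: \<phi>_def)
  \<comment> \<open>Each coefficient of p is visible in the component of the piece containing its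
    exponent. Injectivity and the control of degrees in the preimage both rest on this.\<close>
  have lookup_phi: "Poly_Mapping.lookup p k = Poly_Mapping.lookup (t (h j) * \<phi> p j) k"
    if "j \<in> J" "k \<in> S j" for p j k
    using that by (simp add: restr_phi[symmetric] lookup_restrict_keys)
  have "inj_on \<phi> (carrier ?M)"
  proof (rule inj_onI)
    fix p q assume pq: "p \<in> carrier ?M" "q \<in> carrier ?M" "\<phi> p = \<phi> q"
    show "p = q"
    proof (rule poly_mapping_eqI)
      fix k
      show "Poly_Mapping.lookup p k = Poly_Mapping.lookup q k"
      proof (cases "k \<in> B")
        case True
        then show ?thesis using lookup_phi pq(3) unfolding B by (metis UN_E)
      next
        case False
        then have "k \<notin> Poly_Mapping.keys p" "k \<notin> Poly_Mapping.keys q" using pq(1,2) by auto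
        then show ?thesis by (simp add: in_keys_iff)
      qed
    qed
  qed
  moreover have surj: "\<exists>p\<in>carrier ?M. q = \<phi> p" if q: "q \<in> carrier ?N" for q
  proof
    \<comment> \<open>The preimage undoes each shift and adds the results. The summands have
      exponents in disjoint pieces, so projecting to \<open>S i\<close> recovers only the one with
      index \<open>i\<close>.\<close>
    define p where "p = (\<Sum>j\<in>J. t (h j) * q j)"
    have k: "Poly_Mapping.keys (t (h j) * q j) \<subseteq> S j" if "j \<in> J" for j
    proof -
      have "Poly_Mapping.keys (q j) \<subseteq> (\<lambda>s. s - h j) ` S j"
        using q that I[OF that] unfolding carN by auto
      then show ?thesis using t_keys[of "h j" "q j"] by fastforce
    qed
    have "Poly_Mapping.keys p \<subseteq> (\<Union>j\<in>J. Poly_Mapping.keys (t (h j) * q j))"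
      unfolding p_def by (rule keys_sum)
    then show "p \<in> carrier ?M" using k unfolding B by fastforce
    have restr_p: "restrict_keys (S i) p = t (h i) * q i" if i: "i \<in> J" for i
    proof -
      have "restrict_keys (S i) (t (h j) * q j) = (if j = i then t (h i) * q i else 0)" if "j \<in> J" for j
        using k[OF that] disj[OF that i]
        by (cases "j = i") (auto intro!: restrict_keys_id restrict_keys_disjoint)
      then have "restrict_keys (S i) p = (\<Sum>j\<in>J. if j = i then t (h i) * q i else 0)"
        unfolding p_def restrict_keys_sum by (intro sum.cong) auto
      then show ?thesis using J i by simp
    qed
    have "q \<in> extensional J" using q unfolding carN by (auto simp: PiE_def)
    then show "q = \<phi> p"
      by (intro extensionalityI[of q J]) (auto simp: \<phi>_def restr_p)
  qed
  ultimately show "bij_betw \<phi> (carrier ?M) (carrier ?N)"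
    using phi_car by (auto simp: bij_betw_def)
  show "\<phi> (x \<oplus>\<^bsub>?M\<^esub> y) = \<phi> x \<oplus>\<^bsub>?N\<^esub> \<phi> y" for x y
    by (auto simp: \<phi>_def direct_sum_def twist_def ideal_module_def restrict_keys_add distrib_left semigroup_ring_def)
  show "\<phi> \<zero>\<^bsub>?M\<^esub> = \<zero>\<^bsub>?N\<^esub>"
    by (auto simp: \<phi>_def direct_sum_def twist_def ideal_module_def semigroup_ring_def)
  show "\<phi> (a \<odot>\<^bsub>?M\<^esub> x) = a \<odot>\<^bsub>?N\<^esub> \<phi> x" if a: "a \<in> carrier ?R" and x: "x \<in> carrier ?M" for a x
  proof -
    have "restrict_keys (S j) (a * x) = a * restrict_keys (S j) x" if j: "j \<in> J" for j
    proof (rule restrict_keys_mult[where A = A and B = B])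
      \<comment> \<open>An exponent of \<open>B\<close> outside \<open>S j\<close> lies in another
        piece, which is stable under \<open>A\<close> and disjoint from \<open>S j\<close>.\<close>
      fix b s assume b: "b \<in> A" and "s \<in> B - S j"
      then obtain i where i: "i \<in> J" "s \<in> S i" "i \<noteq> j" unfolding B by blast
      with stable[OF i(1) b i(2)] disj[OF i(1) j i(3)] show "b + s \<notin> S j" by blast
    qed (use a x stable[OF j] in auto)
    then show ?thesis
      by (auto simp: \<phi>_def direct_sum_def twist_def ideal_module_def semigroup_ring_def mult.left_commute
        intro!: restrict_ext)
  qed
  show "\<phi> ` homog ?M g = homog ?N g" for g
  proof
    show "\<phi> ` homog ?M g \<subseteq> homog ?N g"
    proof
      fix q assume "q \<in> \<phi> ` homog ?M g"
      then obtain p where p: "Poly_Mapping.keys p \<subseteq> {g}" "q = \<phi> p" by auto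
      have "Poly_Mapping.keys (t (- h j) * restrict_keys (S j) p) \<subseteq> {g - h j}" for j
        using t_keys[of "- h j" "restrict_keys (S j) p"] p(1) by (auto simp: keys_restrict_keys)
      then show "q \<in> homog ?N g" unfolding homN using p(2) phi_I by (auto simp: \<phi>_def)
    qed
    show "homog ?N g \<subseteq> \<phi> ` homog ?M g"
    proof
      fix q assume q: "q \<in> homog ?N g"
      then have "q \<in> carrier ?N" unfolding homN carN by (auto simp: PiE_def Pi_def)
      then obtain p where p: "p \<in> carrier ?M" "q = \<phi> p" using surj by blast
      \<comment> \<open>The coefficient of \<open>p\<close> at \<open>k\<close> is one of t^(h_j)
        q_j, whose only possible exponent is h_j + (g - h_j) = g.\<close>
      have "k = g" if k: "k \<in> Poly_Mapping.keys p" for k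
      proof -
        from k p(1) obtain j where j: "j \<in> J" "k \<in> S j" unfolding B by auto
        have "k \<in> Poly_Mapping.keys (t (h j) * q j)"
          using k lookup_phi[OF j] p(2) by (simp add: in_keys_iff)
        moreover have "Poly_Mapping.keys (q j) \<subseteq> {g - h j}" using q j(1) unfolding homN by auto
        ultimately show ?thesis using t_keys[of "h j" "q j"] by fastforce
      qed
      then show "q \<in> \<phi> ` homog ?M g" using p by auto
    qed
  qed
qed

section \<open>Coordinates\<close>

lemma rat_vec_simps:
  "rat_vec (x + y) = rat_vec x + rat_vec y"
  "rat_vec (x - y) = rat_vec x - rat_vec y"
  "rat_vec 0 = 0"
  "rat_vec (c *s x) = of_int c *s rat_vec x"
  by (simp_all add: rat_vec_def vec_eq_iff)

lemma rat_vec_sum: "rat_vec (sum f F) = (\<Sum>i\<in>F. rat_vec (f i))"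
  by (induction F rule: infinite_finite_induct) (simp_all add: rat_vec_simps)

lemma rat_vec_inject [simp]: "rat_vec x = rat_vec y \<longleftrightarrow> x = y"
  by (simp add: rat_vec_def vec_eq_iff)

lemma monoid_closure_sum:
  "(\<And>i. i \<in> F \<Longrightarrow> f i \<in> monoid_closure X) \<Longrightarrow> sum f F \<in> monoid_closure X"
  by (induction F rule: infinite_finite_induct) (auto intro: monoid_closure.intros)

lemma monoid_closure_nat_scale:
  fixes x :: "int ^ 'n"
  assumes "x \<in> monoid_closure X"
  shows "int n *s x \<in> monoid_closure X"
proof (induction n)
  case (Suc n)
  have "int (Suc n) *s x = x + int n *s x" by (simp add: vec_eq_iff algebra_simps)
  with Suc assms show ?case by (simp add: monoid_closure.add)
qed (simp add: monoid_closure.zero)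

text \<open>Coefficients are attached to indices, so one form covers both the family
  \<open>e\<close> and, with the identity as \<open>f\<close>, a finite generating set of
  \<open>B\<close>.\<close>

lemma monoid_closure_image_iff:
  fixes f :: "'i \<Rightarrow> int ^ 'n"
  assumes "finite I"
  shows "x \<in> monoid_closure (f ` I) \<longleftrightarrow> (\<exists>c::'i \<Rightarrow> nat. x = (\<Sum>i\<in>I. int (c i) *s f i))"
proof
  assume "x \<in> monoid_closure (f ` I)"
  then show "\<exists>c::'i \<Rightarrow> nat. x = (\<Sum>i\<in>I. int (c i) *s f i)"
  proof induction
    case zero
    show ?case by (intro exI[of _ "\<lambda>_. 0"]) simp
  next
    case (base x)
    then obtain j where j: "j \<in> I" "x = f j" by blast
    have "(\<Sum>i\<in>I. int (if i = j then 1 else 0) *s f i) = (\<Sum>i\<in>I. if i = j then f j else 0)"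
      by (intro sum.cong) auto
    then show ?case using j assms by (intro exI[of _ "\<lambda>i. if i = j then 1 else 0"]) simp
  next
    case (add x y)
    then obtain c c' where "x = (\<Sum>i\<in>I. int (c i) *s f i)" "y = (\<Sum>i\<in>I. int (c' i) *s f i)"
      by blast
    then have "x + y = (\<Sum>i\<in>I. int (c i + c' i) *s f i)"
      by (simp add: sum.distrib vector_sadd_rdistrib)
    then show ?case by (intro exI[of _ "\<lambda>i. c i + c' i"])
  qed
next
  assume "\<exists>c::'i \<Rightarrow> nat. x = (\<Sum>i\<in>I. int (c i) *s f i)"
  then obtain c :: "'i \<Rightarrow> nat" where "x = (\<Sum>i\<in>I. int (c i) *s f i)" by blast
  then show "x \<in> monoid_closure (f ` I)"
    by (simp add: monoid_closure_sum monoid_closure_nat_scale monoid_closure.base)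
qed

lemma group_closure_monoid_closure_image:
  fixes f :: "'i \<Rightarrow> int ^ 'n"
  assumes "finite I" "x \<in> group_closure (monoid_closure (f ` I))"
  shows "\<exists>c. x = (\<Sum>i\<in>I. c i *s f i)"
  using assms(2)
proof induction
  case (base x)
  then have "x \<in> monoid_closure (f ` I)" by (auto intro: monoid_closure.zero)
  then obtain c :: "'i \<Rightarrow> nat" where "x = (\<Sum>i\<in>I. int (c i) *s f i)"
    using monoid_closure_image_iff[OF assms(1)] by blast
  then show ?case by (intro exI[of _ "\<lambda>i. int (c i)"])
next
  case (diff x y)
  then obtain c c' where "x = (\<Sum>i\<in>I. c i *s f i)" "y = (\<Sum>i\<in>I. c' i *s f i)"
    by blast
  then have "x - y = (\<Sum>i\<in>I. (c i - c' i) *s f i)"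
    by (simp add: sum_subtractf vector_sub_rdistrib)
  then show ?case by (intro exI[of _ "\<lambda>i. c i - c' i"])
qed

text \<open>The product of the denominators works. Nonnegativity makes the multiples natural numbers
  and not merely integers, as membership in a monoid demands.\<close>

lemma exists_common_denominator:
  fixes c :: "'i \<Rightarrow> rat"
  assumes "finite I" "\<And>i. i \<in> I \<Longrightarrow> 0 \<le> c i"
  shows "\<exists>N::nat. N > 0 \<and> (\<forall>i\<in>I. of_nat N * c i \<in> \<nat>)"
  using assms
proof (induction I rule: finite_induct)
  case empty
  show ?case by (intro exI[of _ 1]) simp
next
  case (insert j I)
  then obtain N :: nat where N: "N > 0" "\<forall>i\<in>I. of_nat N * c i \<in> \<nat>" by auto
  obtain a b where ab: "quotient_of (c j) = (a, b)" by fastforce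
  then have b: "b > 0" and c: "c j = of_int a / of_int b"
    by (auto simp: quotient_of_denom_pos quotient_of_div)
  have "a \<ge> 0" using insert.prems[of j] b c by (simp add: zero_le_divide_iff)
  then have j: "of_nat (nat b) * c j = of_nat (nat a)"
    using b c by (simp add: of_nat_nat)
  show ?case
  proof (intro exI[of _ "N * nat b"] conjI ballI)
    show "N * nat b > 0" using N b by simp
    fix i assume "i \<in> insert j I"
    then consider "i = j" | "i \<in> I" by blast
    then show "of_nat (N * nat b) * c i \<in> \<nat>"
    proof cases
      case 1
      have "of_nat (N * nat b) * c i = of_nat N * (of_nat (nat b) * c j)" using 1 by simp
      also have "\<dots> = of_nat (N * nat a)" unfolding j by simp
      finally show ?thesis by (simp only: of_nat_in_Nats)
    next
      case 2
      then have "of_nat (nat b) * (of_nat N * c i) \<in> \<nat>"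
        using Nats_mult[OF of_nat_in_Nats bspec[OF N(2)]] by blast
      then show ?thesis by (simp add: mult_ac)
    qed
  qed
qed

text \<open>\<open>coord\<close> looks up its coefficient by the vector
  \<open>rat_vec (e i)\<close>; distinctness of the vectors allows reading it by the index
  \<open>i\<close>, and independence makes it unique.\<close>

lemma coord_eqI:
  assumes e: "lin_indep_family d e" and i: "i \<in> {1..d}"
    and x: "rat_vec x = (\<Sum>i=1..d. c i *s rat_vec (e i))"
  shows "coord d e x i = c i"
proof -
  let ?E = "rat_vec ` e ` {1..d}"
  have ind: "vec.independent ?E" and inj: "inj_on e {1..d}"
    using e by (auto simp: lin_indep_family_def)
  have sp: "rat_vec (e j) \<in> vec.span ?E" if "j \<in> {1..d}" for j
    using that by (intro vec.span_base) auto
  have rb: "vec.representation ?E (rat_vec (e j)) (rat_vec (e i)) = (if j = i then 1 else 0)"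
    if "j \<in> {1..d}" for j
  proof -
    have "rat_vec (e j) \<in> ?E" using that by blast
    moreover have "e i = e j \<longleftrightarrow> j = i" using inj_on_eq_iff[OF inj i that] by auto
    ultimately show ?thesis using vec.representation_basis[OF ind] by simp
  qed
  have "coord d e x i = (\<Sum>j=1..d. vec.representation ?E (c j *s rat_vec (e j)) (rat_vec (e i)))"
    unfolding coord_def x
    by (subst vec.representation_sum[OF ind]) (intro vec.span_scale sp, assumption, simp)
  also have "\<dots> = (\<Sum>j=1..d. if j = i then c i else 0)"
  proof (intro sum.cong refl)
    fix j assume j: "j \<in> {1..d}"
    show "vec.representation ?E (c j *s rat_vec (e j)) (rat_vec (e i)) = (if j = i then c i else 0)"
      by (simp only: vec.representation_scale[OF ind sp[OF j]] rb[OF j]) simp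
  qed
  finally show ?thesis using i by simp
qed

lemma rat_cone_image_coefficients:
  assumes e: "lin_indep_family d e" and v: "v \<in> rat_cone (rat_vec ` e ` {1..d})"
  shows "\<exists>c. (\<forall>i. 0 \<le> c i) \<and> v = (\<Sum>i=1..d. c i *s rat_vec (e i))"
proof -
  from v obtain F c where F: "finite F" "F \<subseteq> rat_vec ` e ` {1..d}" "\<forall>x\<in>F. 0 \<le> c x"
    and v: "v = (\<Sum>x\<in>F. c x *s x)" unfolding rat_cone_def by blast
  have inj: "inj_on (\<lambda>i. rat_vec (e i)) {1..d}"
  proof (rule inj_onI)
    fix i j assume "i \<in> {1..d}" "j \<in> {1..d}" "rat_vec (e i) = rat_vec (e j)"
    then show "i = j" using e by (auto simp: lin_indep_family_def dest: inj_onD)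
  qed
  \<comment> \<open>Generators that the given combination omits receive coefficient 0, which extends
    the sum to the whole family before it is reindexed.\<close>
  let ?c = "\<lambda>x. if x \<in> F then c x else 0"
  have "v = (\<Sum>x\<in>rat_vec ` e ` {1..d}. ?c x *s x)"
    unfolding v by (rule sum.mono_neutral_cong_left) (use F in auto)
  also have "\<dots> = (\<Sum>i=1..d. ?c (rat_vec (e i)) *s rat_vec (e i))"
    unfolding image_image by (subst sum.reindex[OF inj]) (simp add: o_def)
  finally show ?thesis
    by (intro exI[of _ "\<lambda>i. ?c (rat_vec (e i))"] conjI) (use F(3) in simp_all)
qed

lemma in_rat_cone: "v \<in> X \<Longrightarrow> v \<in> rat_cone X"
  unfolding rat_cone_def by (rule CollectI, rule exI[of _ "{v}"], rule exI[of _ "\<lambda>_. 1"]) simp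

section \<open>Base elements of \<open>B\<close> over \<open>A\<close>\<close>

locale simplicial_semigroup =
  fixes B A :: "(int ^ 'n) set" and d :: nat and e :: "nat \<Rightarrow> int ^ 'n"
  assumes B: "affine_semigroup B"
    and e_in_B: "\<forall>i\<in>{1..d}. e i \<in> B"
    and indep: "lin_indep_family d e"
    and cone: "rat_cone (rat_vec ` e ` {1..d}) = rat_cone (rat_vec ` B)"
    and A_def: "A = monoid_closure (e ` {1..d})"
begin

lemma B_zero: "0 \<in> B" and B_add: "x \<in> B \<Longrightarrow> y \<in> B \<Longrightarrow> x + y \<in> B"
  using B by (auto simp: affine_semigroup_def intro: monoid_closure.intros)

lemma A_zero: "0 \<in> A" and A_add: "x \<in> A \<Longrightarrow> y \<in> A \<Longrightarrow> x + y \<in> A"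
  unfolding A_def by (auto intro: monoid_closure.intros)

lemma A_iff: "x \<in> A \<longleftrightarrow> (\<exists>c::nat \<Rightarrow> nat. x = (\<Sum>i=1..d. int (c i) *s e i))"
  unfolding A_def by (rule monoid_closure_image_iff) simp

lemma A_subset_B: "A \<subseteq> B"
proof
  fix x assume "x \<in> A"
  then show "x \<in> B"
    unfolding A_def by induction (use B_zero B_add e_in_B in auto)
qed

text \<open>The cone condition enters here: it places \<open>b\<close> in the cone of the
  \<open>e i\<close>, and independence identifies the nonnegative coefficients found there with
  \<open>coord\<close>.\<close>

lemma B_coefficients:
  assumes "b \<in> B"
  shows "rat_vec b = (\<Sum>i=1..d. coord d e b i *s rat_vec (e i))"
    and "i \<in> {1..d} \<Longrightarrow> 0 \<le> coord d e b i"
proof -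
  have "rat_vec b \<in> rat_cone (rat_vec ` e ` {1..d})"
    unfolding cone using assms by (intro in_rat_cone) simp
  then obtain c where c: "\<forall>i. 0 \<le> c i" "rat_vec b = (\<Sum>i=1..d. c i *s rat_vec (e i))"
    using rat_cone_image_coefficients[OF indep] by blast
  have eq: "coord d e b i = c i" if "i \<in> {1..d}" for i
    using coord_eqI[OF indep that c(2)] .
  show "rat_vec b = (\<Sum>i=1..d. coord d e b i *s rat_vec (e i))"
    unfolding c(2) using eq by (intro sum.cong) auto
  show "i \<in> {1..d} \<Longrightarrow> 0 \<le> coord d e b i" using eq c(1) by simp
qed

lemma in_A_if_Nats_coefficients:
  assumes "rat_vec x = (\<Sum>i=1..d. c i *s rat_vec (e i))" "\<And>i. i \<in> {1..d} \<Longrightarrow> c i \<in> \<nat>"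
  shows "x \<in> A"
proof -
  have "\<forall>i\<in>{1..d}. \<exists>n. c i = of_nat n" using assms(2) by (metis Nats_cases)
  then obtain n where n: "\<And>i. i \<in> {1..d} \<Longrightarrow> c i = of_nat (n i)" by metis
  have "rat_vec x = rat_vec (\<Sum>i=1..d. int (n i) *s e i)"
    unfolding assms(1) rat_vec_sum by (intro sum.cong) (auto simp: rat_vec_simps n)
  then show ?thesis unfolding A_iff by (simp only: rat_vec_inject) blast
qed

lemma multiple_in_A:
  assumes "b \<in> B"
  shows "\<exists>N::nat. N > 0 \<and> int N *s b \<in> A"
proof -
  obtain N :: nat where N: "N > 0" "\<forall>i\<in>{1..d}. of_nat N * coord d e b i \<in> \<nat>"
    using exists_common_denominator[of "{1..d}" "coord d e b"] B_coefficients(2)[OF assms] by auto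
  have "rat_vec (int N *s b) = (\<Sum>i=1..d. (of_nat N * coord d e b i) *s rat_vec (e i))"
    by (simp add: rat_vec_simps B_coefficients(1)[OF assms] vec.scale_sum_right)
  then have "int N *s b \<in> A" by (rule in_A_if_Nats_coefficients) (use N in auto)
  with N show ?thesis by blast
qed

text \<open>For each generator x of \<open>B\<close> some positive multiple N x lies in
  \<open>A\<close>. If a nonzero x occurred at least N times in a base element, that multiple could
  be subtracted without leaving \<open>B\<close>. Hence all coefficients are bounded.\<close>

lemma finite_base_elements: "finite (base_elements B A)"
proof -
  obtain X where X: "finite X" "B = monoid_closure X" using B by (auto simp: affine_semigroup_def)
  have "\<forall>x\<in>X. \<exists>N::nat. N > 0 \<and> int N *s x \<in> A"
    using multiple_in_A X(2) by (auto intro: monoid_closure.base)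
  then obtain N :: "_ \<Rightarrow> nat" where N: "\<And>x. x \<in> X \<Longrightarrow> N x > 0" "\<And>x. x \<in> X \<Longrightarrow> int (N x) *s x \<in> A"
    by metis
  have B_iff: "y \<in> B \<longleftrightarrow> (\<exists>c::_ \<Rightarrow> nat. y = (\<Sum>x\<in>X. int (c x) *s x))" for y
    using monoid_closure_image_iff[OF X(1), of y "\<lambda>x. x"] X(2) by simp
  have "base_elements B A \<subseteq> (\<lambda>c. \<Sum>x\<in>X. int (c x) *s x) ` (\<Pi>\<^sub>E x\<in>X. {..<N x})"
  proof
    fix b assume b: "b \<in> base_elements B A"
    then obtain c0 :: "_ \<Rightarrow> nat" where c0: "b = (\<Sum>x\<in>X. int (c0 x) *s x)"
      using B_iff by (auto simp: base_elements_def)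
    \<comment> \<open>A zero generator gives no nonzero element of \<open>A\<close> to subtract, so
      its coefficient could not be bounded; it is set to 0, which leaves the sum unchanged.\<close>
    define c where "c = (\<lambda>x\<in>X. if x = 0 then 0 else c0 x)"
    have c: "b = (\<Sum>x\<in>X. int (c x) *s x)"
      unfolding c0 c_def by (intro sum.cong) auto
    have "c x < N x" if x: "x \<in> X" for x
    proof (rule ccontr)
      assume le: "\<not> c x < N x"
      with N(1)[OF x] x have x0: "x \<noteq> 0" by (auto simp: c_def)
      \<comment> \<open>The subtraction of natural numbers is exact because
        \<open>N x \<le> c x\<close>, so \<open>?c\<close> is a valid coefficient family witnessing
        membership in \<open>B\<close>.\<close>
      let ?c = "c(x := c x - N x)"
      have "b - int (N x) *s x = (\<Sum>y\<in>X. int (c y) *s y - (if y = x then int (N x) *s x else 0))"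
        using x X(1) by (simp add: c sum_subtractf)
      also have "\<dots> = (\<Sum>y\<in>X. int (?c y) *s y)"
        using le by (intro sum.cong) (auto simp: vector_sub_rdistrib of_nat_diff)
      finally have "b - int (N x) *s x \<in> B" using B_iff by blast
      moreover have "int (N x) *s x \<in> A - {0}" using N[OF x] x0 by (auto simp: vec_eq_iff)
      ultimately show False using b by (auto simp: base_elements_def)
    qed
    then have "c \<in> (\<Pi>\<^sub>E x\<in>X. {..<N x})" by (auto simp: c_def)
    with c show "b \<in> (\<lambda>c. \<Sum>x\<in>X. int (c x) *s x) ` (\<Pi>\<^sub>E x\<in>X. {..<N x})" by blast
  qed
  then show ?thesis by (rule finite_subset) (intro finite_imageI finite_PiE X(1) finite_lessThan)
qed

text \<open>Subtracting a nonzero element of \<open>A\<close> lowers the coordinate sum, which is nonnegative on \<open>B\<close>,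
  by at least 1.\<close>

lemma B_eq_base_plus_A:
  assumes "b \<in> B"
  shows "\<exists>x\<in>base_elements B A. \<exists>a\<in>A. b = x + a"
  using assms
\<comment> \<open>Coordinates are rational, so the measure is the floor of their sum; a drop by at
  least 1 still lowers the floor.\<close>
proof (induction "nat \<lfloor>\<Sum>i=1..d. coord d e b i\<rfloor>" arbitrary: b rule: less_induct)
  case less
  show ?case
  proof (cases "b \<in> base_elements B A")
    case True
    then show ?thesis using A_zero by force
  next
    case False
    then obtain a where a: "a \<in> A" "a \<noteq> 0" "b - a \<in> B"
      using less.prems by (auto simp: base_elements_def)
    then obtain n :: "nat \<Rightarrow> nat" where n: "a = (\<Sum>i=1..d. int (n i) *s e i)" using A_iff by blast
    have "\<exists>j\<in>{1..d}. n j \<noteq> 0"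
    proof (rule ccontr)
      assume "\<not> ?thesis"
      then have "a = 0" unfolding n by (intro sum.neutral) auto
      with a(2) show False by simp
    qed
    then have "1 \<le> (\<Sum>i=1..d. n i)" by (simp add: Suc_le_eq sum_pos2 sum_eq_0_iff flip: neq0_conv)
    then have n1: "1 \<le> (\<Sum>i=1..d. (of_nat (n i) :: rat))"
      unfolding of_nat_sum[symmetric] of_nat_1[symmetric, where 'a = rat] of_nat_le_iff .
    have "rat_vec b = rat_vec (b - a) + rat_vec a" by (simp add: rat_vec_simps)
    also have "\<dots> = (\<Sum>i=1..d. (coord d e (b - a) i + of_nat (n i)) *s rat_vec (e i))"
    proof -
      have "rat_vec a = (\<Sum>i=1..d. of_nat (n i) *s rat_vec (e i))"
        unfolding n rat_vec_sum by (simp add: rat_vec_simps)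
      then show ?thesis
        unfolding B_coefficients(1)[OF a(3)] by (simp only: sum.distrib vec.scale_left_distrib)
    qed
    \<comment> \<open>Uniqueness of coordinates turns the vector identity into an identity between
      coordinate sums.\<close>
    finally have "(\<Sum>i=1..d. coord d e b i) = (\<Sum>i=1..d. coord d e (b - a) i + of_nat (n i))"
      using coord_eqI[OF indep] by (intro sum.cong) auto
    then have "(\<Sum>i=1..d. coord d e (b - a) i) + 1 \<le> (\<Sum>i=1..d. coord d e b i)"
      using n1 by (simp add: sum.distrib)
    moreover have "0 \<le> (\<Sum>i=1..d. coord d e (b - a) i)"
      using B_coefficients(2)[OF a(3)] by (intro sum_nonneg) auto
    ultimately have "nat \<lfloor>\<Sum>i=1..d. coord d e (b - a) i\<rfloor> < nat \<lfloor>\<Sum>i=1..d. coord d e b i\<rfloor>"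
      by linarith
    from less.hyps[OF this a(3)] obtain x a' where "x \<in> base_elements B A" "a' \<in> A" "b - a = x + a'"
      by blast
    then have "b = x + (a' + a)" "a' + a \<in> A" using a(1) A_add by (auto simp: algebra_simps)
    with \<open>x \<in> base_elements B A\<close> show ?thesis by blast
  qed
qed

section \<open>Congruence classes of base elements and their shift vectors\<close>

text \<open>Base elements lie in \<open>B\<close> and so in the group it generates; hence within
  them a class is cut out by the congruence modulo G(A) alone.\<close>

lemma base_classesE:
  assumes "\<Gamma> \<in> base_classes B A"
  obtains x where "x \<in> base_elements B A" "\<Gamma> = {y \<in> base_elements B A. x - y \<in> group_closure A}"
proof -
  have "base_elements B A \<subseteq> group_closure B"
    by (auto simp: base_elements_def intro: group_closure.base)
  with assms show thesis
    unfolding base_classes_def sim_rel_def by (elim quotientE) (rule that, auto)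
qed

lemma base_element_in_class:
  assumes "x \<in> base_elements B A"
  shows "\<exists>\<Gamma>\<in>base_classes B A. x \<in> \<Gamma>"
proof -
  have "(x, x) \<in> Restr (sim_rel B A) (base_elements B A)"
    using assms by (auto simp: sim_rel_def base_elements_def intro: group_closure.base)
  then show ?thesis
    unfolding base_classes_def by (intro bexI[OF _ quotientI[OF assms]]) (rule ImageI[OF _ singletonI])
qed

text \<open>For representatives u and v of the two classes, u - v is the sum of u - x, x - y and y -
  v, all in the group G(A). Congruence to u and to v is then the same condition.\<close>

lemma base_classes_eqI:
  assumes "\<Gamma> \<in> base_classes B A" "\<Delta> \<in> base_classes B A" "x \<in> \<Gamma>" "y \<in> \<Delta>" "x - y \<in> group_closure A"
  shows "\<Gamma> = \<Delta>"
proof -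
  obtain u where u: "u \<in> base_elements B A" "\<Gamma> = {y \<in> base_elements B A. u - y \<in> group_closure A}"
    using assms(1) by (rule base_classesE)
  obtain v where v: "v \<in> base_elements B A" "\<Delta> = {y \<in> base_elements B A. v - y \<in> group_closure A}"
    using assms(2) by (rule base_classesE)
  have uv: "u - v \<in> group_closure A"
  proof -
    have "(u - x) + (x - y) - (v - y) \<in> group_closure A"
      using assms(3-5) unfolding u(2) v(2)
      by (intro group_closure.diff[of "(u - x) + (x - y)" A "v - y"] group_closure_add) auto
    then show ?thesis by simp
  qed
  have "u - z \<in> group_closure A \<longleftrightarrow> v - z \<in> group_closure A" for z
    using group_closure.diff[OF _ uv, of "u - z"] group_closure_add[OF uv, of "v - z"] by auto
  then show ?thesis unfolding u(2) v(2) by simp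
qed

text \<open>An element of G(A) is an integer combination of the \<open>e i\<close>, and by
  uniqueness of coordinates these integers are the differences.\<close>

lemma coord_diff_Ints:
  assumes "x \<in> B" "y \<in> B" "x - y \<in> group_closure A" "i \<in> {1..d}"
  shows "coord d e x i - coord d e y i \<in> \<int>"
proof -
  obtain c where c: "x - y = (\<Sum>i=1..d. c i *s e i)"
    using group_closure_monoid_closure_image[of "{1..d}" "x - y" e] assms(3) A_def by auto
  have "rat_vec x = rat_vec y + rat_vec (x - y)" by (simp add: rat_vec_simps)
  also have "\<dots> = (\<Sum>i=1..d. (coord d e y i + of_int (c i)) *s rat_vec (e i))"
    unfolding B_coefficients(1)[OF assms(2)] c rat_vec_sum
    by (simp add: rat_vec_simps sum.distrib vec.scale_left_distrib)
  finally show ?thesis using coord_eqI[OF indep assms(4)] by simp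
qed

text \<open>In each direction the minimum is attained, since the class is finite. The difference to
  it is nonnegative by minimality and integral because it compares two congruent elements, so all
  coordinates of x - h are natural numbers.\<close>

lemma diff_shift_vector_in_A:
  assumes \<Gamma>: "\<Gamma> \<in> base_classes B A" and x: "x \<in> \<Gamma>"
  shows "x - shift_vector d e \<Gamma> \<in> A"
proof -
  obtain u where u: "\<Gamma> = {y \<in> base_elements B A. u - y \<in> group_closure A}"
    using base_classesE[OF \<Gamma>] by blast
  have \<Gamma>B: "y \<in> B" if "y \<in> \<Gamma>" for y using that u by (auto simp: base_elements_def)
  have fin: "finite \<Gamma>" using u finite_base_elements by auto
  define m where "m i = Min {coord d e y i | y. y \<in> \<Gamma>}" for i
  have nat: "coord d e y i - m i \<in> \<nat>" if y: "y \<in> \<Gamma>" and i: "i \<in> {1..d}" for y i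
  proof -
    let ?C = "{coord d e y i | y. y \<in> \<Gamma>}"
    have C: "finite ?C" "?C \<noteq> {}" using fin y by (auto simp: setcompr_eq_image)
    \<comment> \<open>The minimizer \<open>z\<close> depends on \<open>i\<close>; different
      coordinates may attain their minima at different elements of the class.\<close>
    obtain z where z: "z \<in> \<Gamma>" "m i = coord d e z i"
      using Min_in[OF C] unfolding m_def by auto
    have "m i \<le> coord d e y i" unfolding m_def using C y by (intro Min_le) auto
    moreover have "(u - z) - (u - y) \<in> group_closure A"
      using y z(1) u by (intro group_closure.diff[of "u - z" A "u - y"]) auto
    then have "coord d e y i - m i \<in> \<int>"
      unfolding z(2) by (intro coord_diff_Ints[OF \<Gamma>B[OF y] \<Gamma>B[OF z(1)] _ i]) simp
    ultimately show ?thesis by (simp add: Nats_altdef2)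
  qed
  let ?m = "\<Sum>i=1..d. m i *s rat_vec (e i)"
  have diff: "rat_vec y - ?m = (\<Sum>i=1..d. (coord d e y i - m i) *s rat_vec (e i))" if "y \<in> \<Gamma>" for y
    using B_coefficients(1)[OF \<Gamma>B[OF that]] by (simp add: vec.scale_left_diff_distrib sum_subtractf)
  have "\<forall>i\<in>{1..d}. \<exists>n. coord d e x i - m i = of_nat n" using nat[OF x] by (metis Nats_cases)
  then obtain n where n: "\<And>i. i \<in> {1..d} \<Longrightarrow> coord d e x i - m i = of_nat (n i)" by metis
  \<comment> \<open>Subtracting from \<open>x\<close> the natural combination of the
    \<open>e i\<close> with coefficients \<open>n i\<close> exhibits an integer vector with image
    \<open>?m\<close>. With injectivity of \<open>rat_vec\<close> this justifies the
    \<open>THE\<close> in \<open>shift_vector\<close>.\<close>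
  have "rat_vec (\<Sum>i=1..d. int (n i) *s e i) = rat_vec x - ?m"
    unfolding diff[OF x] rat_vec_sum by (intro sum.cong) (auto simp: rat_vec_simps n)
  then have h: "rat_vec (x - (\<Sum>i=1..d. int (n i) *s e i)) = ?m" by (simp add: rat_vec_simps)
  have "rat_vec (shift_vector d e \<Gamma>) = ?m"
    unfolding shift_vector_def m_def[symmetric]
    by (rule theI[where P = "\<lambda>h. rat_vec h = ?m", OF h]) (metis h rat_vec_inject)
  then have "rat_vec (x - shift_vector d e \<Gamma>) = (\<Sum>i=1..d. (coord d e x i - m i) *s rat_vec (e i))"
    using diff[OF x] by (simp add: rat_vec_simps)
  then show ?thesis by (rule in_A_if_Nats_coefficients) (rule nat[OF x])
qed

end

theorem proposition2p1:
  fixes K :: "'k::field itself"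
    and B A :: "(int ^ 'n) set"
    and d :: nat
    and e :: "nat \<Rightarrow> int ^ 'n"
  assumes "affine_semigroup B"
    and "\<forall>i\<in>{1..d}. e i \<in> B"
    and "lin_indep_family d e"
    and "rat_cone (rat_vec ` e ` {1..d}) = rat_cone (rat_vec ` B)"
    and "A = monoid_closure (e ` {1..d})"
  shows "graded_isomorphic (semigroup_ring K A)
    (semigroup_ring K B)
    (direct_sum (base_classes B A)
      (\<lambda>\<Gamma>. twist (ideal_module (semigroup_ring K A) (class_ideal K d e A \<Gamma>))
                   (- shift_vector d e \<Gamma>)))"
proof -
  interpret simplicial_semigroup B A d e
    by (rule simplicial_semigroup.intro) (fact assms)+
  define S where "S \<Gamma> = {x + a | x a. x \<in> \<Gamma> \<and> a \<in> A}" for \<Gamma>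
  have class_subset: "\<Gamma> \<subseteq> base_elements B A" if "\<Gamma> \<in> base_classes B A" for \<Gamma>
    using that by (rule base_classesE) auto
  have A_closure: "a \<in> group_closure A" if "a \<in> A" for a
    using that by (simp add: group_closure.base)
  show ?thesis
  proof (rule semigroup_ring_decomposition[where S = S])
    show "0 \<in> A" by (rule A_zero)
    show "a + b \<in> A" if "a \<in> A" "b \<in> A" for a b using that by (rule A_add)
    have "base_classes B A \<subseteq> Pow (base_elements B A)" using class_subset by blast
    then show "finite (base_classes B A)"
      by (rule finite_subset) (simp add: finite_base_elements)
    show "B = (\<Union>\<Gamma>\<in>base_classes B A. S \<Gamma>)"
    proof (intro subset_antisym subsetI)
      fix b assume "b \<in> B"
      then obtain x a where xa: "x \<in> base_elements B A" "a \<in> A" "b = x + a"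
        using B_eq_base_plus_A by blast
      moreover obtain \<Gamma> where "\<Gamma> \<in> base_classes B A" "x \<in> \<Gamma>"
        using base_element_in_class[OF xa(1)] by blast
      ultimately show "b \<in> (\<Union>\<Gamma>\<in>base_classes B A. S \<Gamma>)" unfolding S_def by blast
    next
      fix b assume "b \<in> (\<Union>\<Gamma>\<in>base_classes B A. S \<Gamma>)"
      then obtain \<Gamma> x a where "\<Gamma> \<in> base_classes B A" "x \<in> \<Gamma>" "a \<in> A" "b = x + a"
        unfolding S_def by blast
      then show "b \<in> B"
        using class_subset A_subset_B B_add[of x a] by (auto simp: base_elements_def)
    qed
    show "S \<Gamma> \<inter> S \<Delta> = {}"
      if classes: "\<Gamma> \<in> base_classes B A" "\<Delta> \<in> base_classes B A" and "\<Gamma> \<noteq> \<Delta>" for \<Gamma> \<Delta>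
    proof (rule ccontr)
      assume "S \<Gamma> \<inter> S \<Delta> \<noteq> {}"
      then obtain x a y b where xy: "x \<in> \<Gamma>" "y \<in> \<Delta>" "a \<in> A" "b \<in> A" "x + a = y + b"
        unfolding S_def by blast
      \<comment> \<open>A common element of two pieces would make x and y congruent modulo G(A),
        which forces the classes to coincide.\<close>
      then have "x - y = b - a" by (simp add: algebra_simps)
      then have "x - y \<in> group_closure A"
        using group_closure.diff[OF A_closure[OF xy(4)] A_closure[OF xy(3)]] by simp
      then show False using base_classes_eqI[OF classes xy(1,2)] \<open>\<Gamma> \<noteq> \<Delta>\<close> by blast
    qed
    show "a + s \<in> S \<Gamma>" if a: "a \<in> A" and "s \<in> S \<Gamma>" for \<Gamma> a s
    proof -
      from that obtain x b where "x \<in> \<Gamma>" "b \<in> A" "s = x + b" unfolding S_def by blast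
      then have "a + s = x + (a + b)" "a + b \<in> A" using a A_add by (auto simp: algebra_simps)
      with \<open>x \<in> \<Gamma>\<close> show ?thesis unfolding S_def by blast
    qed
    show "s - shift_vector d e \<Gamma> \<in> A" if \<Gamma>: "\<Gamma> \<in> base_classes B A" and "s \<in> S \<Gamma>" for \<Gamma> s
    proof -
      from that obtain x a where xa: "x \<in> \<Gamma>" "a \<in> A" "s = x + a" unfolding S_def by blast
      then have "s - shift_vector d e \<Gamma> = (x - shift_vector d e \<Gamma>) + a" by simp
      then show ?thesis using A_add[OF diff_shift_vector_in_A[OF \<Gamma> xa(1)] xa(2)] by (simp only:)
    qed
    show "class_ideal K d e A \<Gamma> =
        {p. Poly_Mapping.keys p \<subseteq> (\<lambda>s. s - shift_vector d e \<Gamma>) ` S \<Gamma>}"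
      if \<Gamma>: "\<Gamma> \<in> base_classes B A" for \<Gamma>
    proof -
      let ?h = "shift_vector d e \<Gamma>"
      \<comment> \<open>The generators are reindexed by the translated class \<Gamma> - h, a subset
        of \<open>A\<close>; translation commutes with adding \<open>A\<close>, so the exponent set
        of the ideal is the translate of \<open>S \<Gamma>\<close>.\<close>
      have monomials: "{Poly_Mapping.single (x - ?h) 1 | x. x \<in> \<Gamma>} =
          {Poly_Mapping.single y (1::'k) | y. y \<in> (\<lambda>x. x - ?h) ` \<Gamma>}" by blast
      have "(\<lambda>s. s - ?h) ` S \<Gamma> = {x + a - ?h | x a. x \<in> \<Gamma> \<and> a \<in> A}"
        unfolding S_def by blast
      also have "\<dots> = {x - ?h + a | x a. x \<in> \<Gamma> \<and> a \<in> A}"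
        by (simp only: diff_add_eq)
      also have "\<dots> = {y + a | y a. y \<in> (\<lambda>x. x - ?h) ` \<Gamma> \<and> a \<in> A}"
        by blast
      finally have S_shift:
        "(\<lambda>s. s - ?h) ` S \<Gamma> = {y + a | y a. y \<in> (\<lambda>x. x - ?h) ` \<Gamma> \<and> a \<in> A}" .
      have "(\<lambda>x. x - ?h) ` \<Gamma> \<subseteq> A" using diff_shift_vector_in_A[OF \<Gamma>] by blast
      then have "genideal (semigroup_ring K A)
          {Poly_Mapping.single y 1 | y. y \<in> (\<lambda>x. x - ?h) ` \<Gamma>} =
          {p. Poly_Mapping.keys p \<subseteq> {y + a | y a. y \<in> (\<lambda>x. x - ?h) ` \<Gamma> \<and> a \<in> A}}"
        by (intro genideal_monomials A_zero A_add)
      then show ?thesis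
        by (simp only: class_ideal_def monomials S_shift)
    qed
  qed
qed

end
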